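(* For all integers $n,k\ge0$ we have \[ \mathrm{ac}^k(n) = \sum_{i+j+r+s=n-2k} (-1)^i\binom{k}{i}\binom{j+k}{j}\binom{j}{r}\binom{r}{s} - \sum_{i+j+r+s=n-2k-2} (-1)^i\binom{k}{i}\binom{j+k}{j}\binom{j}{r}\binom{r}{s}. \]
   Context: A composition of $n$ is a finite sequence $\alpha=(\alpha_1,\ldots,\alpha_\ell)$ of positive integers with $\alpha_1+\cdots+\alpha_\ell=n$; the empty sequence ($\ell=0$) is the only composition of $0$. $\mathrm{ac}^k(n)$ is the number of compositions $\alpha=(\alpha_1,\ldots,\alpha_\ell)$ of $n$ such that $\#\{1\le i\le \ell/2:\alpha_i=\alpha_{\ell+1-i}\}=k$. Convention for binomial coefficients, for integers $a,b$: $\binom{a}{b}=\frac{a!}{b!(a-b)!}$ if $a\ge b\ge1$; $\binom{a}{b}=1$ if $b=0$; $\binom{a}{b}=0$ otherwise. Summation indices range over nonnegative integers (so a sum whose target value is negative is empty and equals $0$). *)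

theory Defs
  imports Complex_Main
begin

definition compositions :: "nat \<Rightarrow> nat list set" where
  "compositions n = {\<alpha>. (\<forall>a\<in>set \<alpha>. 0 < a) \<and> sum_list \<alpha> = n}"

lemma finite_compositions: "finite (compositions n)"
proof (rule finite_subset)
  have "length \<alpha> \<le> sum_list \<alpha>" if "\<forall>a\<in>set \<alpha>. 0 < a" for \<alpha> :: "nat list"
    using that by (induction \<alpha>) auto
  then show "compositions n \<subseteq> {\<alpha>. set \<alpha> \<subseteq> {..n} \<and> length \<alpha> \<le> n}"
    by (auto simp: compositions_def member_le_sum_list)
  show "finite {\<alpha>. set \<alpha> \<subseteq> {..n} \<and> length \<alpha> \<le> n}"
    by (rule finite_lists_length_le) simp
qed

text \<open>
  The parts of a composition are numbered from 1, list entries from 0: the part with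
  number i is \<open>\<alpha> ! (i - 1)\<close>, and its mirror image, the part with number
  \<open>length \<alpha> + 1 - i\<close>, is \<open>\<alpha> ! (length \<alpha> - i)\<close>.
\<close>

definition mirror_matches :: "nat list \<Rightarrow> nat set" where
  "mirror_matches \<alpha> =
     {i. 1 \<le> i \<and> real i \<le> real (length \<alpha>) / 2 \<and> \<alpha> ! (i - 1) = \<alpha> ! (length \<alpha> - i)}"

definition ac :: "nat \<Rightarrow> nat \<Rightarrow> nat" where
  "ac k n = card {\<alpha> \<in> compositions n. card (mirror_matches \<alpha>) = k}"

text \<open>
  The target is an integer, so that a negative one gives the empty set.
\<close>

definition quads :: "int \<Rightarrow> (nat \<times> nat \<times> nat \<times> nat) set" where
  "quads m = {(i, j, r, s). int i + int j + int r + int s = m}"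

lemma finite_quads: "finite (quads m)"
proof (rule finite_subset)
  show "quads m \<subseteq> {..nat m} \<times> {..nat m} \<times> {..nat m} \<times> {..nat m}"
    by (auto simp: quads_def)
qed simp

end

theory Submission
  imports Defs "HOL-Computational_Algebra.Formal_Power_Series"
begin

text \<open>
  Write \<open>A\<^sub>k\<close> for the generating function of \<open>ac k n\<close> in \<open>n\<close>. Removing the first and the last
  part of a composition leaves a composition, with one matching pair fewer if the two parts agree
  and as many matching pairs otherwise. Two equal positive parts have the generating function
  \<open>E = X\<^sup>2 / (1 - X\<^sup>2)\<close>, two unequal ones \<open>U = X\<^sup>2 / (1 - X)\<^sup>2 - E\<close>, and the compositions with at most
  one part, which have no pair to remove, \<open>1 / (1 - X)\<close>. Hence \<open>A\<^sub>0 = 1 / (1 - X) + U A\<^sub>0\<close> and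
  \<open>A\<^bsub>k+1\<^esub> = E A\<^sub>k + U A\<^bsub>k+1\<^esub>\<close> (lemmas \<open>ac_fps_0\<close> and \<open>ac_fps_Suc\<close>).

  With \<open>Q = 1 - X - X\<^sup>2 - X\<^sup>3\<close> one has \<open>(1 - X) (1 - X\<^sup>2) (1 - U) = Q\<close>. Multiplying both equations
  by \<open>(1 - X) (1 - X\<^sup>2)\<close> therefore clears all denominators, and they become
  \<open>Q A\<^sub>0 = 1 - X\<^sup>2\<close> and \<open>Q A\<^bsub>k+1\<^esub> = X\<^sup>2 (1 - X) A\<^sub>k\<close>. By induction the \<open>(k+1)\<close>-st power of \<open>Q\<close> times
  \<open>A\<^sub>k\<close> is the product of \<open>1 - X\<^sup>2\<close> and the \<open>k\<close>-th power of \<open>X\<^sup>2 (1 - X)\<close>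
  (lemma \<open>ac_fps_closed_form\<close>).

  On the other side, let \<open>G\<^sub>k\<close> be the generating function, in the target value \<open>m\<close>, of the sum over
  the quadruples. In it the index \<open>i\<close> contributes the \<open>k\<close>-th power of \<open>1 - X\<close>, and the indices \<open>r\<close>
  and \<open>s\<close> expand the \<open>j\<close>-th power of \<open>F = X (1 + X (1 + X)) = 1 - Q\<close>. What remains is the negative
  binomial series in \<open>j\<close> evaluated at \<open>F\<close>, that is, the inverse of the \<open>(k+1)\<close>-st power of
  \<open>1 - F = Q\<close> (lemmas \<open>quad_sum_fps\<close> and \<open>neg_binomial_fps_compose\<close>). So \<open>A\<^sub>k\<close> is \<open>G\<^sub>k\<close> times
  \<open>1 - X\<^sup>2\<close> times the \<open>2k\<close>-th power of \<open>X\<close>. These factors shift the target to \<open>n - 2k\<close> and subtract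
  the same sum with target \<open>n - 2k - 2\<close>.

  The denominators are kept on the other side of the equations, so that all series have integer
  coefficients and the argument takes place in the integral domain \<open>int fps\<close>.
\<close>

unbundle fps_syntax

section \<open>Generating functions of weighted classes\<close>

definition counting_fps :: "('a \<Rightarrow> nat) \<Rightarrow> 'a set \<Rightarrow> int fps" where
  "counting_fps w A = Abs_fps (\<lambda>n. int (card {x \<in> A. w x = n}))"

text \<open>
  Infinite sets have cardinality 0, so \<^term>\<open>counting_fps w A\<close> really counts only if every weight
  is attained finitely often.
\<close>

definition finite_levels :: "('a \<Rightarrow> nat) \<Rightarrow> 'a set \<Rightarrow> bool" where
  "finite_levels w A \<longleftrightarrow> (\<forall>n. finite {x \<in> A. w x = n})"

lemma finite_levels_subset:
  assumes "finite_levels w B" "A \<subseteq> B"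
  shows "finite_levels w A"
  unfolding finite_levels_def
proof
  fix n
  show "finite {x \<in> A. w x = n}"
    by (rule finite_subset[of _ "{x \<in> B. w x = n}"]) (use assms in \<open>auto simp: finite_levels_def\<close>)
qed

lemma counting_fps_Un:
  assumes "finite_levels w A" "finite_levels w B" "A \<inter> B = {}"
  shows "counting_fps w (A \<union> B) = counting_fps w A + counting_fps w B"
proof (rule fps_ext)
  fix n
  have "{x \<in> A \<union> B. w x = n} = {x \<in> A. w x = n} \<union> {x \<in> B. w x = n}"
    by auto
  moreover have "card \<dots> = card {x \<in> A. w x = n} + card {x \<in> B. w x = n}"
    using assms by (intro card_Un_disjoint) (auto simp: finite_levels_def)
  ultimately show "counting_fps w (A \<union> B) $ n = (counting_fps w A + counting_fps w B) $ n"
    by (simp add: counting_fps_def)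
qed

lemma counting_fps_image:
  assumes "inj_on f A"
  shows "counting_fps w (f ` A) = counting_fps (w \<circ> f) A"
proof (rule fps_ext)
  fix n
  have "{y \<in> f ` A. w y = n} = f ` {x \<in> A. (w \<circ> f) x = n}"
    by auto
  moreover have "inj_on f {x \<in> A. (w \<circ> f) x = n}"
    using assms by (rule inj_on_subset) auto
  ultimately show "counting_fps w (f ` A) $ n = counting_fps (w \<circ> f) A $ n"
    by (simp add: counting_fps_def card_image)
qed

lemma finite_levels_image: "finite_levels (w \<circ> f) A \<Longrightarrow> finite_levels w (f ` A)"
  unfolding finite_levels_def
proof
  fix n
  assume "\<forall>n. finite {x \<in> A. (w \<circ> f) x = n}"
  moreover have "{y \<in> f ` A. w y = n} = f ` {x \<in> A. (w \<circ> f) x = n}"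
    by auto
  ultimately show "finite {y \<in> f ` A. w y = n}"
    by simp
qed

lemma level_Times:
  fixes v :: "'a \<Rightarrow> nat" and w :: "'b \<Rightarrow> nat"
  shows "{x \<in> A \<times> B. (case x of (a, b) \<Rightarrow> v a + w b) = n}
    = (\<Union>i\<in>{0..n}. {a \<in> A. v a = i} \<times> {b \<in> B. w b = n - i})"
  by auto

lemma finite_levels_Times:
  assumes "finite_levels v A" "finite_levels w B"
  shows "finite_levels (\<lambda>(a, b). v a + w b) (A \<times> B)"
  using assms unfolding finite_levels_def level_Times by auto

lemma counting_fps_Times:
  assumes "finite_levels v A" "finite_levels w B"
  shows "counting_fps (\<lambda>(a, b). v a + w b) (A \<times> B) = counting_fps v A * counting_fps w B"
proof (rule fps_ext)
  fix n
  have "card (\<Union>i\<in>{0..n}. {a \<in> A. v a = i} \<times> {b \<in> B. w b = n - i})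
      = (\<Sum>i=0..n. card ({a \<in> A. v a = i} \<times> {b \<in> B. w b = n - i}))"
    using assms by (intro card_UN_disjoint) (auto simp: finite_levels_def)
  then show "counting_fps (\<lambda>(a, b). v a + w b) (A \<times> B) $ n
      = (counting_fps v A * counting_fps w B) $ n"
    by (simp add: counting_fps_def level_Times fps_mult_nth card_cartesian_product)
qed

section \<open>Peeling off the outermost pair of parts\<close>

lemma mirror_matches_alt:
  "mirror_matches \<alpha> = {i. 1 \<le> i \<and> 2 * i \<le> length \<alpha> \<and> \<alpha> ! (i - 1) = \<alpha> ! (length \<alpha> - i)}"
proof -
  have "real i \<le> real (length \<alpha>) / 2 \<longleftrightarrow> 2 * i \<le> length \<alpha>" for i
    by linarith
  then show ?thesis
    by (simp add: mirror_matches_def)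
qed

lemma mirror_matches_short: "length \<alpha> \<le> 1 \<Longrightarrow> mirror_matches \<alpha> = {}"
  by (auto simp: mirror_matches_alt)

text \<open>
  The mirror image of part \<open>i + 1\<close> of the longer list is the mirror image of part \<open>i\<close> of the inner
  list, so enclosing a list shifts its matches by one and can add only the outermost pair.
\<close>

lemma mirror_matches_wrap:
  "mirror_matches (a # \<beta> @ [b]) = (if a = b then {1} else {}) \<union> Suc ` mirror_matches \<beta>"
  (is "?L = ?R")
proof (rule set_eqI)
  fix i
  consider "i = 0" | "i = 1" | l where "i = Suc (Suc l)"
    by (metis One_nat_def not0_implies_Suc)
  then show "i \<in> ?L \<longleftrightarrow> i \<in> ?R"
  proof cases
    case 1
    then show ?thesis by (auto simp: mirror_matches_alt)
  next
    case 2
    then show ?thesis by (auto simp: mirror_matches_alt)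
  next
    case 3
    show ?thesis
    proof (cases "2 * Suc l \<le> length \<beta>")
      case True
      then have "length (a # \<beta> @ [b]) - i = Suc (length \<beta> - Suc l)"
        using 3 by simp
      moreover have "(a # \<beta> @ [b]) ! Suc (length \<beta> - Suc l) = \<beta> ! (length \<beta> - Suc l)"
        using True by (simp add: nth_append_left)
      moreover have "(a # \<beta> @ [b]) ! (i - 1) = \<beta> ! l"
        using True 3 by (simp add: nth_append)
      ultimately show ?thesis
        using True 3 by (auto simp: mirror_matches_alt)
    next
      case False
      then show ?thesis
        using 3 by (auto simp: mirror_matches_alt)
    qed
  qed
qed

lemma card_mirror_matches_wrap:
  "card (mirror_matches (a # \<beta> @ [b])) = of_bool (a = b) + card (mirror_matches \<beta>)"
proof -
  have "finite (mirror_matches \<beta>)"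
    by (rule finite_subset[of _ "{..length \<beta>}"]) (auto simp: mirror_matches_alt)
  moreover have "1 \<notin> Suc ` mirror_matches \<beta>"
    by (auto simp: mirror_matches_alt)
  ultimately show ?thesis
    by (simp add: mirror_matches_wrap card_image)
qed

definition matching_class :: "nat \<Rightarrow> nat list set" where
  "matching_class k = {\<alpha>. (\<forall>a\<in>set \<alpha>. 0 < a) \<and> card (mirror_matches \<alpha>) = k}"

lemma counting_fps_matching_class:
  "counting_fps sum_list (matching_class k) = Abs_fps (\<lambda>n. int (ac k n))"
proof -
  have "{\<alpha> \<in> matching_class k. sum_list \<alpha> = n}
      = {\<alpha> \<in> compositions n. card (mirror_matches \<alpha>) = k}" for n
    by (auto simp: matching_class_def compositions_def)
  then show ?thesis
    by (simp add: counting_fps_def ac_def)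
qed

lemma finite_levels_compositions: "finite_levels sum_list {\<alpha>. \<forall>a\<in>set \<alpha>. 0 < (a::nat)}"
  using finite_compositions by (simp add: finite_levels_def compositions_def)

definition wrap :: "(nat \<times> nat) \<times> nat list \<Rightarrow> nat list" where
  "wrap = (\<lambda>((a, b), \<beta>). a # \<beta> @ [b])"

lemma inj_wrap: "inj wrap"
  by (auto simp: inj_def wrap_def)

definition equal_pairs :: "(nat \<times> nat) set" where
  "equal_pairs = {(a, b). 0 < a \<and> a = b}"

definition unequal_pairs :: "(nat \<times> nat) set" where
  "unequal_pairs = {(a, b). 0 < a \<and> 0 < b \<and> a \<noteq> b}"

definition short_compositions :: "nat list set" where
  "short_compositions = {\<alpha>. (\<forall>a\<in>set \<alpha>. 0 < a) \<and> length \<alpha> \<le> 1}"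

lemma list_short_or_wrap:
  obtains "length \<alpha> \<le> 1" | a \<beta> b where "\<alpha> = a # \<beta> @ [b]"
proof (cases \<alpha>)
  case (Cons a \<gamma>)
  then show ?thesis
    using that by (cases \<gamma> rule: rev_cases) auto
qed (use that in auto)

text \<open>
  The next two decompositions are the combinatorial core. A composition without matches cannot be
  enclosed by two equal parts. For a positive number of matches the short compositions drop out,
  and the outermost pair either is one of the matches or is not.
\<close>

lemma matching_class_0:
  "matching_class 0 = short_compositions \<union> wrap ` (unequal_pairs \<times> matching_class 0)" (is "_ = ?R")
proof
  show "matching_class 0 \<subseteq> ?R"
  proof
    fix \<alpha> assume \<alpha>: "\<alpha> \<in> matching_class 0"
    show "\<alpha> \<in> ?R"
    proof (cases \<alpha> rule: list_short_or_wrap)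
      case 1
      then show ?thesis using \<alpha> by (simp add: matching_class_def short_compositions_def)
    next
      case (2 a \<beta> b)
      then have "((a, b), \<beta>) \<in> unequal_pairs \<times> matching_class 0"
        using \<alpha> by (auto simp: matching_class_def unequal_pairs_def card_mirror_matches_wrap)
      moreover have "\<alpha> = wrap ((a, b), \<beta>)"
        using 2 by (simp add: wrap_def)
      ultimately show ?thesis by blast
    qed
  qed
  show "?R \<subseteq> matching_class 0"
    by (auto simp: matching_class_def short_compositions_def unequal_pairs_def wrap_def
        card_mirror_matches_wrap mirror_matches_short)
qed

lemma matching_class_Suc:
  "matching_class (Suc k) =
    wrap ` (equal_pairs \<times> matching_class k) \<union> wrap ` (unequal_pairs \<times> matching_class (Suc k))"
  (is "_ = ?R")
proof
  show "matching_class (Suc k) \<subseteq> ?R"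
  proof
    fix \<alpha> assume \<alpha>: "\<alpha> \<in> matching_class (Suc k)"
    show "\<alpha> \<in> ?R"
    proof (cases \<alpha> rule: list_short_or_wrap)
      case 1
      then show ?thesis using \<alpha> by (simp add: matching_class_def mirror_matches_short)
    next
      case (2 a \<beta> b)
      then have "((a, b), \<beta>) \<in> equal_pairs \<times> matching_class k
          \<union> unequal_pairs \<times> matching_class (Suc k)"
        using \<alpha> by (cases "a = b")
          (auto simp: matching_class_def unequal_pairs_def equal_pairs_def card_mirror_matches_wrap)
      moreover have "\<alpha> = wrap ((a, b), \<beta>)"
        using 2 by (simp add: wrap_def)
      ultimately show ?thesis by blast
    qed
  qed
  show "?R \<subseteq> matching_class (Suc k)"
    by (auto simp: matching_class_def equal_pairs_def unequal_pairs_def wrap_def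
        card_mirror_matches_wrap)
qed

lemma finite_levels_matching_class: "finite_levels sum_list (matching_class k)"
  by (rule finite_levels_subset[OF finite_levels_compositions]) (auto simp: matching_class_def)

lemma finite_levels_short_compositions: "finite_levels sum_list short_compositions"
  by (rule finite_levels_subset[OF finite_levels_compositions]) (auto simp: short_compositions_def)

abbreviation pair_sum :: "nat \<times> nat \<Rightarrow> nat" where
  "pair_sum \<equiv> (\<lambda>(a, b). a + b)"

lemma finite_levels_pairs: "finite_levels pair_sum (P :: (nat \<times> nat) set)"
proof -
  have "finite_levels pair_sum (UNIV \<times> UNIV)"
    using finite_levels_Times[of "\<lambda>a. a" "UNIV :: nat set" "\<lambda>b. b" "UNIV :: nat set"]
    by (simp add: finite_levels_def)
  then show ?thesis
    by (rule finite_levels_subset) simp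
qed

lemma sum_list_wrap: "sum_list \<circ> wrap = (\<lambda>(p, \<beta>). pair_sum p + sum_list \<beta>)"
  by (auto simp: wrap_def)

lemma finite_levels_wrap: "finite_levels sum_list (wrap ` (P \<times> matching_class k))"
  by (intro finite_levels_image)
    (simp only: sum_list_wrap finite_levels_Times finite_levels_pairs finite_levels_matching_class)

lemma counting_fps_wrap:
  "counting_fps sum_list (wrap ` (P \<times> matching_class k))
    = counting_fps pair_sum P * Abs_fps (\<lambda>n. int (ac k n))"
proof -
  have "counting_fps sum_list (wrap ` (P \<times> matching_class k))
      = counting_fps (\<lambda>(p, \<beta>). pair_sum p + sum_list \<beta>) (P \<times> matching_class k)"
    by (metis counting_fps_image inj_wrap inj_on_subset subset_UNIV sum_list_wrap)
  also have "\<dots> = counting_fps pair_sum P * counting_fps sum_list (matching_class k)"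
    by (rule counting_fps_Times[OF finite_levels_pairs finite_levels_matching_class])
  finally show ?thesis
    by (simp only: counting_fps_matching_class)
qed

text \<open>
  The two recursions only translate the decompositions: the weight of an enclosed list is the sum
  of the weights of its pair of outer parts and of its inner list.
\<close>

lemma ac_fps_0:
  "Abs_fps (\<lambda>n. int (ac 0 n)) = counting_fps sum_list short_compositions
    + counting_fps pair_sum unequal_pairs * Abs_fps (\<lambda>n. int (ac 0 n))"
proof -
  have "short_compositions \<inter> wrap ` (unequal_pairs \<times> matching_class 0) = {}"
    by (auto simp: short_compositions_def wrap_def)
  then have "counting_fps sum_list (short_compositions \<union> wrap ` (unequal_pairs \<times> matching_class 0))
     = counting_fps sum_list short_compositions
     + counting_fps sum_list (wrap ` (unequal_pairs \<times> matching_class 0))"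
    by (intro counting_fps_Un finite_levels_short_compositions finite_levels_wrap)
  then show ?thesis
    by (simp only: counting_fps_wrap counting_fps_matching_class flip: matching_class_0)
qed

lemma ac_fps_Suc:
  "Abs_fps (\<lambda>n. int (ac (Suc k) n)) =
     counting_fps pair_sum equal_pairs * Abs_fps (\<lambda>n. int (ac k n))
    + counting_fps pair_sum unequal_pairs * Abs_fps (\<lambda>n. int (ac (Suc k) n))"
proof -
  have "wrap ` (equal_pairs \<times> matching_class k)
      \<inter> wrap ` (unequal_pairs \<times> matching_class (Suc k)) = {}"
    by (auto simp: equal_pairs_def unequal_pairs_def wrap_def)
  then have "counting_fps sum_list (wrap ` (equal_pairs \<times> matching_class k)
        \<union> wrap ` (unequal_pairs \<times> matching_class (Suc k)))
     = counting_fps sum_list (wrap ` (equal_pairs \<times> matching_class k))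
     + counting_fps sum_list (wrap ` (unequal_pairs \<times> matching_class (Suc k)))"
    by (intro counting_fps_Un finite_levels_wrap)
  then show ?thesis
    by (simp only: counting_fps_wrap counting_fps_matching_class flip: matching_class_Suc)
qed

section \<open>The generating function of the compositions with k matching pairs\<close>

lemma counting_fps_short_compositions: "(1 - fps_X) * counting_fps sum_list short_compositions = 1"
proof -
  have "{\<alpha> \<in> short_compositions. sum_list \<alpha> = n} = {if n = 0 then [] else [n]}" for n
    by (auto simp: short_compositions_def le_Suc_eq length_Suc_conv)
  then have "counting_fps sum_list short_compositions = Abs_fps (\<lambda>_. 1)"
    by (simp add: counting_fps_def)
  then show ?thesis
    by (auto intro!: fps_ext simp: algebra_simps)
qed

lemma counting_fps_positive: "(1 - fps_X) * counting_fps (\<lambda>a. a) {a. 0 < a} = fps_X"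
proof -
  have "{a \<in> {a. 0 < a}. a = n} = (if n = 0 then {} else {n})" for n :: nat
    by auto
  then have "counting_fps (\<lambda>a. a) {a. 0 < a} = Abs_fps (\<lambda>n. of_bool (0 < n))"
    by (auto simp: counting_fps_def intro!: fps_ext)
  then show ?thesis
    by (auto intro!: fps_ext simp: algebra_simps)
qed

lemma counting_fps_equal_pairs: "(1 - fps_X\<^sup>2) * counting_fps pair_sum equal_pairs = fps_X\<^sup>2"
proof -
  have "{p \<in> equal_pairs. pair_sum p = n} = (if 0 < n \<and> even n then {(n div 2, n div 2)} else {})"
    for n
    by (auto simp: equal_pairs_def)
  then have "counting_fps pair_sum equal_pairs = Abs_fps (\<lambda>n. of_bool (0 < n \<and> even n))"
    by (auto simp: counting_fps_def intro!: fps_ext)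
  \<comment> \<open>The geometric series in \<open>X\<^sup>2\<close> without its constant term, as a fixed point.\<close>
  moreover have "(Abs_fps (\<lambda>n. of_bool (0 < n \<and> even n)) :: int fps)
      = fps_X\<^sup>2 + fps_X\<^sup>2 * Abs_fps (\<lambda>n. of_bool (0 < n \<and> even n))"
    by (rule fps_ext) (auto simp: fps_X_power_mult_nth)
  ultimately show ?thesis
    by (simp add: algebra_simps)
qed

text \<open>
  Unequal pairs are all pairs without the equal ones, and
  \<open>X\<^sup>2 / (1 - X)\<^sup>2 - X\<^sup>2 / (1 - X\<^sup>2) = 2 X\<^sup>3 / ((1 - X) (1 - X\<^sup>2))\<close>.
\<close>

lemma counting_fps_unequal_pairs:
  "(1 - fps_X) * (1 - fps_X\<^sup>2) * counting_fps pair_sum unequal_pairs = 2 * fps_X ^ 3"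
proof -
  let ?P = "counting_fps (\<lambda>a. a) {a::nat. 0 < a}"
  let ?E = "counting_fps pair_sum equal_pairs"
  let ?U = "counting_fps pair_sum unequal_pairs"
  have "finite_levels (\<lambda>a. a) {a::nat. 0 < a}"
    by (simp add: finite_levels_def)
  then have "?P * ?P = counting_fps pair_sum ({a. 0 < a} \<times> {a. 0 < a})"
    by (simp add: counting_fps_Times)
  also have "{a. 0 < a} \<times> {a. 0 < a} = equal_pairs \<union> unequal_pairs"
    by (auto simp: equal_pairs_def unequal_pairs_def)
  also have "counting_fps pair_sum (equal_pairs \<union> unequal_pairs) = ?E + ?U"
    by (intro counting_fps_Un finite_levels_pairs) (auto simp: equal_pairs_def unequal_pairs_def)
  finally have U: "?U = ?P * ?P - ?E"
    by simp
  \<comment> \<open>Written so that \<open>1 - X\<^sup>2 = (1 + X) (1 - X)\<close> puts one factor \<open>1 - X\<close> next to each \<open>?P\<close>.\<close>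
  have "(1 - fps_X) * (1 - fps_X\<^sup>2) * ?U
      = (1 + fps_X) * ((1 - fps_X) * ?P) * ((1 - fps_X) * ?P) - (1 - fps_X) * ((1 - fps_X\<^sup>2) * ?E)"
    unfolding U by (simp add: algebra_simps power2_eq_square)
  also have "\<dots> = 2 * fps_X ^ 3"
    unfolding counting_fps_positive counting_fps_equal_pairs
    by (simp add: algebra_simps power2_eq_square power3_eq_cube)
  finally show ?thesis .
qed

text \<open>
  The inverse of this polynomial is the generating function of the tribonacci numbers.
\<close>

definition tribonacci_poly :: "int fps" where
  "tribonacci_poly = 1 - fps_X - fps_X\<^sup>2 - fps_X ^ 3"

lemma tribonacci_poly_alt:
  "tribonacci_poly = (1 - fps_X) * (1 - fps_X\<^sup>2) - 2 * fps_X ^ 3"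
  by (simp add: tribonacci_poly_def algebra_simps power2_eq_square power3_eq_cube)

text \<open>
  Solving \<open>A = L + U A\<close> for \<open>A\<close> divides by \<open>1 - U\<close>, which is \<^const>\<open>tribonacci_poly\<close> up to the common
  denominator \<open>(1 - X) (1 - X\<^sup>2)\<close>. Both recursions for the generating functions have this form.
\<close>

lemma tribonacci_poly_mult:
  assumes "A = L + counting_fps pair_sum unequal_pairs * A"
  shows "tribonacci_poly * A = (1 - fps_X) * (1 - fps_X\<^sup>2) * L"
proof -
  let ?M = "(1 - fps_X) * (1 - fps_X\<^sup>2) :: int fps"
  have "?M * A = ?M * L + ?M * counting_fps pair_sum unequal_pairs * A"
    by (subst assms) (simp add: distrib_left mult.assoc)
  then have "?M * A = ?M * L + 2 * fps_X ^ 3 * A"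
    by (simp only: counting_fps_unequal_pairs)
  then show ?thesis
    by (simp add: tribonacci_poly_alt left_diff_distrib)
qed

lemma ac_fps_closed_form:
  "tribonacci_poly ^ (k + 1) * Abs_fps (\<lambda>n. int (ac k n))
    = fps_X ^ (2 * k) * (1 - fps_X\<^sup>2) * (1 - fps_X) ^ k"
proof (induction k)
  case 0
  have "tribonacci_poly * Abs_fps (\<lambda>n. int (ac 0 n))
      = (1 - fps_X) * (1 - fps_X\<^sup>2) * counting_fps sum_list short_compositions"
    by (rule tribonacci_poly_mult[OF ac_fps_0])
  also have "\<dots> = (1 - fps_X\<^sup>2) * ((1 - fps_X) * counting_fps sum_list short_compositions)"
    by (simp only: mult_ac)
  finally show ?case
    by (simp add: counting_fps_short_compositions)
next
  case (Suc k)
  let ?A = "\<lambda>k. Abs_fps (\<lambda>n. int (ac k n))"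
  have "tribonacci_poly * ?A (Suc k)
      = (1 - fps_X) * (1 - fps_X\<^sup>2) * (counting_fps pair_sum equal_pairs * ?A k)"
    by (rule tribonacci_poly_mult[OF ac_fps_Suc])
  also have "\<dots> = (1 - fps_X) * ((1 - fps_X\<^sup>2) * counting_fps pair_sum equal_pairs) * ?A k"
    by (simp only: mult_ac)
  also have "\<dots> = (1 - fps_X) * fps_X\<^sup>2 * ?A k"
    by (simp only: counting_fps_equal_pairs)
  finally have "tribonacci_poly ^ (Suc k + 1) * ?A (Suc k)
      = (1 - fps_X) * fps_X\<^sup>2 * (tribonacci_poly ^ (k + 1) * ?A k)"
    by (simp add: mult_ac)
  also have "\<dots> = fps_X ^ (2 * Suc k) * (1 - fps_X\<^sup>2) * (1 - fps_X) ^ Suc k"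
    unfolding Suc.IH by (simp add: mult_ac power2_eq_square)
  finally show ?case .
qed

section \<open>The generating function of the multiple sum\<close>

definition neg_binomial_fps :: "nat \<Rightarrow> int fps" where
  "neg_binomial_fps k = Abs_fps (\<lambda>j. int ((j + k) choose j))"

text \<open>
  By Pascal's rule, multiplication by \<open>1 - X\<close> lowers the exponent \<open>k + 1\<close> of the pole by one.
\<close>

lemma neg_binomial_fps: "(1 - fps_X) ^ (k + 1) * neg_binomial_fps k = 1"
proof (induction k)
  case 0
  then show ?case
    by (auto intro!: fps_ext simp: neg_binomial_fps_def algebra_simps)
next
  case (Suc k)
  have "(1 - fps_X) * neg_binomial_fps (Suc k) = neg_binomial_fps k"
  proof (rule fps_ext)
    fix n
    show "((1 - fps_X) * neg_binomial_fps (Suc k)) $ n = neg_binomial_fps k $ n"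
      by (cases n) (simp_all add: neg_binomial_fps_def left_diff_distrib)
  qed
  moreover have "(1 - fps_X) ^ (Suc k + 1) * neg_binomial_fps (Suc k)
      = (1 - fps_X) ^ (k + 1) * ((1 - fps_X) * neg_binomial_fps (Suc k))"
    by (simp add: mult_ac)
  ultimately show ?case
    by (simp only: Suc.IH)
qed

text \<open>
  The polynomial is \<open>X + X\<^sup>2 + X\<^sup>3\<close>, nested so that two successive binomial expansions of its powers
  produce the coefficients \<open>j choose r\<close> and \<open>r choose s\<close>.
\<close>

definition step_poly :: "int fps" where
  "step_poly = fps_X * (1 + fps_X * (1 + fps_X))"

text \<open>
  Substitution of a series without constant term is a ring homomorphism, so it may be applied to
  the equation that characterises the negative binomial series.
\<close>

lemma neg_binomial_fps_compose:
  "tribonacci_poly ^ (k + 1) * (neg_binomial_fps k oo step_poly) = 1"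
proof -
  have 0: "step_poly $ 0 = 0"
    by (simp add: step_poly_def)
  have "((1 - fps_X) ^ (k + 1) * neg_binomial_fps k) oo step_poly
      = (1 - step_poly) ^ (k + 1) * (neg_binomial_fps k oo step_poly)"
    by (simp only: fps_compose_mult_distrib[OF 0] fps_compose_power[OF 0, symmetric]
        fps_compose_sub_distrib fps_X_fps_compose_startby0[OF 0] fps_compose_1)
  moreover have "1 - step_poly = tribonacci_poly"
    by (simp add: step_poly_def tribonacci_poly_def algebra_simps power2_eq_square power3_eq_cube)
  ultimately show ?thesis
    by (simp only: neg_binomial_fps fps_compose_1)
qed

lemma one_plus_X_power_nth: "((1 + fps_X :: int fps) ^ r) $ q = int (r choose q)"
proof (induction r arbitrary: q)
  case 0
  then show ?case by (cases q) auto
next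
  case (Suc r)
  then show ?case by (cases q) (auto simp: algebra_simps)
qed

lemma one_minus_X_power_nth: "((1 - fps_X :: int fps) ^ k) $ i = (-1) ^ i * int (k choose i)"
proof (induction k arbitrary: i)
  case 0
  then show ?case by (cases i) auto
next
  case (Suc k)
  then show ?case by (cases i) (auto simp: algebra_simps)
qed

lemma step_poly_power_nth:
  assumes "j \<le> p"
  shows "step_poly ^ j $ p = (\<Sum>r=0..p-j. int (j choose r) * int (r choose (p - j - r)))"
proof -
  let ?q = "p - j"
  have "step_poly ^ j = fps_X ^ j * (1 + fps_X * (1 + fps_X)) ^ j"
    by (simp add: step_poly_def power_mult_distrib)
  then have "step_poly ^ j $ p = ((fps_X * (1 + fps_X) + 1) ^ j) $ ?q"
    using assms by (simp add: fps_X_power_mult_nth add.commute)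
  also have "\<dots> = (\<Sum>r\<le>j. of_nat (j choose r) * (fps_X ^ r * (1 + fps_X) ^ r)) $ ?q"
    by (simp add: binomial_ring power_mult_distrib)
  also have "\<dots> = (\<Sum>r\<le>j. int (j choose r) * (if r \<le> ?q then int (r choose (?q - r)) else 0))"
    by (auto simp: fps_sum_nth fps_X_power_mult_nth one_plus_X_power_nth
        intro!: sum.cong)
  also have "\<dots> = (\<Sum>r=0..?q. int (j choose r) * int (r choose (?q - r)))"
    by (rule sum.mono_neutral_cong) auto
  finally show ?thesis .
qed

lemma sum_quads:
  fixes f :: "nat \<Rightarrow> nat \<Rightarrow> nat \<Rightarrow> nat \<Rightarrow> int"
  shows "(\<Sum>(i, j, r, s)\<in>quads (int m). f i j r s)
    = (\<Sum>i=0..m. \<Sum>j=0..m-i. \<Sum>r=0..m-i-j. f i j r (m - i - j - r))"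
proof -
  have "(\<Sum>i=0..m. \<Sum>j=0..m-i. \<Sum>r=0..m-i-j. f i j r (m - i - j - r))
     = (\<Sum>(i, j, r)\<in>(SIGMA i:{0..m}. SIGMA j:{0..m-i}. {0..m-i-j}). f i j r (m - i - j - r))"
    by (simp add: sum.Sigma)
  also have "\<dots> = (\<Sum>(i, j, r, s)\<in>quads (int m). f i j r s)"
    by (rule sum.reindex_bij_witness[of _ "\<lambda>(i, j, r, s). (i, j, r)"
          "\<lambda>(i, j, r). (i, j, r, m - i - j - r)"]) (auto simp: quads_def)
  finally show ?thesis by simp
qed

definition quad_sum :: "nat \<Rightarrow> int \<Rightarrow> int" where
  "quad_sum k m = (\<Sum>(i, j, r, s)\<in>quads m.
     (-1) ^ i * int (k choose i) * int ((j + k) choose j) * int (j choose r) * int (r choose s))"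

lemma quad_sum_neg: "m < 0 \<Longrightarrow> quad_sum k m = 0"
proof -
  assume "m < 0"
  then have "quads m = {}" by (auto simp: quads_def)
  then show ?thesis by (simp add: quad_sum_def)
qed

text \<open>
  Once \<open>s\<close> is eliminated, the nested sums over \<open>i\<close>, \<open>j\<close> and \<open>r\<close> are those of the product with the
  power of \<open>1 - X\<close>, of the composition, and of the powers of \<^const>\<open>step_poly\<close>.
\<close>

lemma quad_sum_fps:
  "Abs_fps (\<lambda>m. quad_sum k (int m)) = (1 - fps_X) ^ k * (neg_binomial_fps k oo step_poly)"
proof (rule fps_ext)
  fix m
  have "((1 - fps_X) ^ k * (neg_binomial_fps k oo step_poly)) $ m
     = (\<Sum>i=0..m. (-1) ^ i * int (k choose i) *
         (\<Sum>j=0..m-i. int ((j + k) choose j) *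
           (\<Sum>r=0..m-i-j. int (j choose r) * int (r choose (m - i - j - r)))))"
    by (simp add: fps_mult_nth one_minus_X_power_nth fps_compose_nth neg_binomial_fps_def
        step_poly_power_nth)
  also have "\<dots> = quad_sum k (int m)"
    unfolding quad_sum_def sum_quads by (simp add: sum_distrib_left mult_ac)
  finally show "Abs_fps (\<lambda>m. quad_sum k (int m)) $ m
      = ((1 - fps_X) ^ k * (neg_binomial_fps k oo step_poly)) $ m"
    by simp
qed

lemma ac_fps_eq_quad_sum_fps:
  "Abs_fps (\<lambda>n. int (ac k n))
    = fps_X ^ (2 * k) * (1 - fps_X\<^sup>2) * Abs_fps (\<lambda>m. quad_sum k (int m))"
proof -
  have "tribonacci_poly ^ (k + 1)
      * (fps_X ^ (2 * k) * (1 - fps_X\<^sup>2) * Abs_fps (\<lambda>m. quad_sum k (int m)))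
    = fps_X ^ (2 * k) * (1 - fps_X\<^sup>2) * (1 - fps_X) ^ k
      * (tribonacci_poly ^ (k + 1) * (neg_binomial_fps k oo step_poly))"
    unfolding quad_sum_fps by (simp only: mult_ac)
  also have "\<dots> = tribonacci_poly ^ (k + 1) * Abs_fps (\<lambda>n. int (ac k n))"
    by (simp only: neg_binomial_fps_compose ac_fps_closed_form mult_1_right)
  finally have "tribonacci_poly ^ (k + 1) * Abs_fps (\<lambda>n. int (ac k n)) = tribonacci_poly ^ (k + 1)
      * (fps_X ^ (2 * k) * (1 - fps_X\<^sup>2) * Abs_fps (\<lambda>m. quad_sum k (int m)))" ..
  \<comment> \<open>The power has an inverse, so it can be cancelled.\<close>
  moreover have "tribonacci_poly ^ (k + 1) \<noteq> 0"
    using neg_binomial_fps_compose[of k] by (metis mult_zero_left zero_neq_one)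
  ultimately show ?thesis
    by (simp only: mult_cancel_left) simp
qed

theorem theorem2p4:
  fixes n k :: nat
  shows "int (ac k n) =
      (\<Sum>(i, j, r, s)\<in>quads (int n - 2 * int k).
         (-1) ^ i * int (k choose i) * int ((j + k) choose j) * int (j choose r) * int (r choose s))
    - (\<Sum>(i, j, r, s)\<in>quads (int n - 2 * int k - 2).
         (-1) ^ i * int (k choose i) * int ((j + k) choose j) * int (j choose r) * int (r choose s))"
proof -
  let ?G = "Abs_fps (\<lambda>m. quad_sum k (int m))"
  \<comment> \<open>Subtracting in the integers is sound: a negative target gives an empty sum, just as the shifted
      series has no coefficients below \<open>d\<close>.\<close>
  have shift: "(fps_X ^ d * ?G) $ n = quad_sum k (int n - int d)" for d
    by (auto simp: fps_X_power_mult_nth quad_sum_neg)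
  have "int (ac k n) = Abs_fps (\<lambda>n. int (ac k n)) $ n"
    by simp
  also have "Abs_fps (\<lambda>n. int (ac k n)) = fps_X ^ (2 * k) * ?G - fps_X ^ (2 * k + 2) * ?G"
    unfolding ac_fps_eq_quad_sum_fps by (simp add: algebra_simps power2_eq_square)
  also have "\<dots> $ n = quad_sum k (int n - 2 * int k) - quad_sum k (int n - 2 * int k - 2)"
    using shift[of "2 * k"] shift[of "2 * k + 2"] by (simp add: algebra_simps)
  finally show ?thesis
    by (simp only: quad_sum_def)
qed

end
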